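(* Let $G$ be a graph and $S \subseteq V(G)$. Then $S$ is a redundant locating-dominating (RED:LD) set of $G$ if and only if all of the following hold: (i) for every $v \in V(G)$, $|N[v] \cap S| \ge 2$; (ii) for every $v \in S$ and every $u \in V(G)-S$, $|((N(v) \cap S) \triangle (N(u) \cap S)) - \{v\}| \ge 1$; (iii) for all $u,v \in V(G)-S$ with $u \neq v$, $|(N(v) \cap S) \triangle (N(u) \cap S)| \ge 2$.
   Context: $N(v)$ denotes the open neighborhood of $v$ and $N[v]=N(v)\cup\{v\}$ the closed neighborhood; $\triangle$ is symmetric difference. A set $S \subseteq V(G)$ is a locating-dominating (LD) set if for all $u,v \in V(G)-S$: $N(v)\cap S \neq \varnothing$, and if $u \ne v$ then $N(v) \cap S \neq N(u) \cap S$. A redundant locating-dominating (RED:LD) set is an LD set $S$ such that for every $v \in S$, the set $S-\{v\}$ is also an LD set. *)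

theory Defs
  imports "Graph_Theory.Pair_Digraph" "HOL-Library.Extended_Nat"
begin

text \<open>
  A (simple, undirected) graph is a \<^locale>\<open>pair_bidirected_digraph\<close>: a vertex set
  \<^term>\<open>pverts G\<close> with a symmetric, irreflexive adjacency relation \<^term>\<open>parcs G\<close> on it.
  This is the library's \<^locale>\<open>pair_graph\<close> without the finiteness requirement, so infinite
  graphs are included.
\<close>

definition open_nbhd :: "'a pair_pre_digraph \<Rightarrow> 'a \<Rightarrow> 'a set" where
  "open_nbhd G v = {u \<in> pverts G. (v, u) \<in> parcs G}"

definition closed_nbhd :: "'a pair_pre_digraph \<Rightarrow> 'a \<Rightarrow> 'a set" where
  "closed_nbhd G v = open_nbhd G v \<union> {v}"

text \<open>
  In an infinite graph the sets being counted may be infinite, where \<^const>\<open>card\<close> would be 0.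
\<close>

definition ecard :: "'a set \<Rightarrow> enat" where
  "ecard A = (if finite A then enat (card A) else \<infinity>)"

definition LD_set :: "'a pair_pre_digraph \<Rightarrow> 'a set \<Rightarrow> bool" where
  "LD_set G S \<longleftrightarrow>
     S \<subseteq> pverts G \<and>
     (\<forall>u \<in> pverts G - S. \<forall>v \<in> pverts G - S.
        open_nbhd G v \<inter> S \<noteq> {} \<and>
        (u \<noteq> v \<longrightarrow> open_nbhd G v \<inter> S \<noteq> open_nbhd G u \<inter> S))"

definition RED_LD_set :: "'a pair_pre_digraph \<Rightarrow> 'a set \<Rightarrow> bool" where
  "RED_LD_set G S \<longleftrightarrow> LD_set G S \<and> (\<forall>v \<in> S. LD_set G (S - {v}))"

end

theory Submission
  imports Defs
begin

text \<open>A set has at least two elements exactly when it is nonempty and stays so after losing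
  any one element (\<open>two_le_ecard_iff\<close>); redundancy asks the same of domination and
  separation when a detector \<open>x\<close> is deleted from \<open>S\<close>. Deletion removes
  \<open>x\<close> from every trace \<open>open_nbhd G v \<inter> S\<close>, hence from every
  symmetric difference of traces, and adds \<open>x\<close> to the vertices to be dominated and
  separated. Closed neighborhoods treat old and new such vertices alike for domination. For
  separation, pairs outside \<open>S\<close> give the bound 2, and pairs containing the deleted
  vertex give the mixed condition.\<close>

lemma one_le_ecard_iff: "1 \<le> ecard A \<longleftrightarrow> A \<noteq> {}"
  by (auto simp: ecard_def one_enat_def Suc_le_eq card_gt_0_iff)

text \<open>Turns counting into survival of one deletion. An infinite set survives because it is not
  contained in a singleton.\<close>

lemma two_le_ecard_iff: "2 \<le> ecard A \<longleftrightarrow> A \<noteq> {} \<and> (\<forall>x\<in>A. A - {x} \<noteq> {})"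
proof (cases "finite A")
  case True
  have "2 \<le> card A \<longleftrightarrow> A \<noteq> {} \<and> (\<forall>x\<in>A. A - {x} \<noteq> {})"
  proof
    assume "2 \<le> card A"
    moreover have "A - {x} \<noteq> {}" if "x \<in> A" for x
    proof
      assume "A - {x} = {}"
      with that have "A = {x}" by blast
      with \<open>2 \<le> card A\<close> show False by simp
    qed
    ultimately show "A \<noteq> {} \<and> (\<forall>x\<in>A. A - {x} \<noteq> {})" by auto
  next
    assume *: "A \<noteq> {} \<and> (\<forall>x\<in>A. A - {x} \<noteq> {})"
    then obtain x y where "{x, y} \<subseteq> A" "x \<noteq> y" by blast
    with True show "2 \<le> card A" using card_mono[of A "{x, y}"] by simp
  qed
  with True show ?thesis by (simp add: ecard_def numeral_eq_enat)
next
  case False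
  then have "A \<noteq> {}" and "A - {x} \<noteq> {}" for x
    by (auto dest: finite_subset[of A "{x}"])
  with False show ?thesis by (simp add: ecard_def)
qed

text \<open>Here \<open>x\<close> is arbitrary, since the deleted detector may lie outside the set
  being counted.\<close>

lemma two_le_ecardD: "2 \<le> ecard A \<Longrightarrow> A - {x} \<noteq> {}"
  by (cases "x \<in> A") (simp_all add: two_le_ecard_iff)

lemma LD_set_nbhd_nonempty:
  "LD_set G S \<Longrightarrow> v \<in> pverts G - S \<Longrightarrow> open_nbhd G v \<inter> S \<noteq> {}"
  unfolding LD_set_def by blast

lemma LD_set_nbhd_neq:
  "LD_set G S \<Longrightarrow> u \<in> pverts G - S \<Longrightarrow> v \<in> pverts G - S \<Longrightarrow> u \<noteq> v
    \<Longrightarrow> open_nbhd G v \<inter> S \<noteq> open_nbhd G u \<inter> S"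
  by (simp add: LD_set_def)

theorem theorem2:
  fixes G :: "'a pair_pre_digraph" and S :: "'a set"
  assumes "pair_bidirected_digraph G"
    and "S \<subseteq> pverts G"
  shows "RED_LD_set G S \<longleftrightarrow>
     (\<forall>v \<in> pverts G. ecard (closed_nbhd G v \<inter> S) \<ge> 2) \<and>
     (\<forall>v \<in> S. \<forall>u \<in> pverts G - S.
        ecard (sym_diff (open_nbhd G v \<inter> S) (open_nbhd G u \<inter> S) - {v}) \<ge> 1) \<and>
     (\<forall>u \<in> pverts G - S. \<forall>v \<in> pverts G - S. u \<noteq> v \<longrightarrow>
        ecard (sym_diff (open_nbhd G v \<inter> S) (open_nbhd G u \<inter> S)) \<ge> 2)"
    (is "_ \<longleftrightarrow> ?dom \<and> ?mixed \<and> ?sep")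
proof
  assume "RED_LD_set G S"
  then have ld: "LD_set G S" and ld': "x \<in> S \<Longrightarrow> LD_set G (S - {x})" for x
    by (simp_all add: RED_LD_set_def)
  have dom: "open_nbhd G v \<inter> S \<noteq> {}" if "v \<in> pverts G - S" for v
    by (rule LD_set_nbhd_nonempty[OF ld that])
  have dom': "open_nbhd G v \<inter> (S - {x}) \<noteq> {}" if "v \<in> pverts G - (S - {x})" "x \<in> S" for v x
    by (rule LD_set_nbhd_nonempty[OF ld'[OF that(2)] that(1)])
  have sep: "open_nbhd G v \<inter> S \<noteq> open_nbhd G u \<inter> S"
    if "u \<in> pverts G - S" "v \<in> pverts G - S" "u \<noteq> v" for u v
    by (rule LD_set_nbhd_neq[OF ld that])
  have sep': "open_nbhd G v \<inter> (S - {x}) \<noteq> open_nbhd G u \<inter> (S - {x})"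
    if "u \<in> pverts G - (S - {x})" "v \<in> pverts G - (S - {x})" "u \<noteq> v" "x \<in> S" for u v x
    by (rule LD_set_nbhd_neq[OF ld'[OF that(4)] that(1-3)])
  have ?dom
  proof
    fix v assume v: "v \<in> pverts G"
    show "2 \<le> ecard (closed_nbhd G v \<inter> S)"
    proof (cases "v \<in> S")
      case True
      \<comment> \<open>Once deleted, \<open>v\<close> must itself be dominated, so it has a
        neighbor in \<open>S - {v}\<close>; \<open>v\<close> is the second element.\<close>
      then show ?thesis
        using dom'[of v v] v unfolding two_le_ecard_iff closed_nbhd_def by blast
    next
      case False
      then show ?thesis
        using dom[of v] dom'[of v] v unfolding two_le_ecard_iff closed_nbhd_def by blast
    qed
  qed
  moreover have ?mixed
  proof (intro ballI)
    \<comment> \<open>After deleting \<open>v\<close>, both \<open>v\<close> and \<open>u\<close>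
      are outside the set and must be told apart without \<open>v\<close>.\<close>
    fix v u assume "v \<in> S" "u \<in> pverts G - S"
    then show "1 \<le> ecard (sym_diff (open_nbhd G v \<inter> S) (open_nbhd G u \<inter> S) - {v})"
      using sep'[of u v v] assms(2) unfolding one_le_ecard_iff by blast
  qed
  moreover have ?sep
  proof (intro ballI impI)
    fix u v assume uv: "u \<in> pverts G - S" "v \<in> pverts G - S" "u \<noteq> v"
    let ?D = "sym_diff (open_nbhd G v \<inter> S) (open_nbhd G u \<inter> S)"
    have "?D \<noteq> {}" using sep[OF uv] by blast
    \<comment> \<open>Elements of \<open>?D\<close> lie in \<open>S\<close>, so \<open>x\<close> is
      a detector that may be deleted.\<close>
    moreover have "?D - {x} \<noteq> {}" if "x \<in> ?D" for x
      using sep'[of u x v] uv that by blast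
    ultimately show "2 \<le> ecard ?D" unfolding two_le_ecard_iff by blast
  qed
  ultimately show "?dom \<and> ?mixed \<and> ?sep" by blast
next
  assume "?dom \<and> ?mixed \<and> ?sep"
  then have ?dom ?mixed ?sep by blast+
  have dom: "closed_nbhd G v \<inter> S - {x} \<noteq> {}" if "v \<in> pverts G" for v x
    by (rule two_le_ecardD[OF bspec[OF \<open>?dom\<close> that]])
  have mixed: "sym_diff (open_nbhd G v \<inter> S) (open_nbhd G u \<inter> S) - {v} \<noteq> {}"
    if "v \<in> S" "u \<in> pverts G - S" for u v
    using bspec[OF bspec[OF \<open>?mixed\<close> that(1)] that(2)] unfolding one_le_ecard_iff .
  have sep: "sym_diff (open_nbhd G v \<inter> S) (open_nbhd G u \<inter> S) - {x} \<noteq> {}"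
    if "u \<in> pverts G - S" "v \<in> pverts G - S" "u \<noteq> v" for u v x
  proof -
    have "2 \<le> ecard (sym_diff (open_nbhd G v \<inter> S) (open_nbhd G u \<inter> S))"
      using \<open>?sep\<close> that by blast
    then show ?thesis by (rule two_le_ecardD)
  qed
  have "LD_set G S"
    unfolding LD_set_def
  proof (intro conjI ballI impI)
    fix u v assume "u \<in> pverts G - S" "v \<in> pverts G - S"
    then show "open_nbhd G v \<inter> S \<noteq> {}"
      using dom[of v v] unfolding closed_nbhd_def by blast
  next
    fix u v assume "u \<in> pverts G - S" "v \<in> pverts G - S" "u \<noteq> v"
    then show "open_nbhd G v \<inter> S \<noteq> open_nbhd G u \<inter> S"
      \<comment> \<open>Only nonemptiness of the symmetric difference matters; the removed vertex
        \<open>u\<close> is an arbitrary choice.\<close>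
      using sep[of u v u] by blast
  qed (fact assms(2))
  moreover have "LD_set G (S - {x})" if x: "x \<in> S" for x
    unfolding LD_set_def
  proof (intro conjI ballI impI)
    show "S - {x} \<subseteq> pverts G" using assms(2) by blast
  next
    fix u v assume "u \<in> pverts G - (S - {x})" "v \<in> pverts G - (S - {x})"
    \<comment> \<open>Either \<open>v = x\<close> or \<open>v\<close> is outside \<open>S\<close>,
      so what remains of the closed neighborhood in \<open>S - {x}\<close> consists of neighbors of
      \<open>v\<close>.\<close>
    then show "open_nbhd G v \<inter> (S - {x}) \<noteq> {}"
      using dom[of v x] unfolding closed_nbhd_def by blast
  next
    fix u v assume uv: "u \<in> pverts G - (S - {x})" "v \<in> pverts G - (S - {x})" "u \<noteq> v"
    \<comment> \<open>The only new vertex outside the set is \<open>x\<close>, and two distinct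
      vertices cannot both be \<open>x\<close>.\<close>
    then consider "v = x" "u \<in> pverts G - S" | "u = x" "v \<in> pverts G - S"
      | "u \<in> pverts G - S" "v \<in> pverts G - S" by blast
    then show "open_nbhd G v \<inter> (S - {x}) \<noteq> open_nbhd G u \<inter> (S - {x})"
    proof cases
      case 1
      then show ?thesis using mixed[of x u] x by blast
    next
      case 2
      then show ?thesis using mixed[of x v] x by blast
    next
      case 3
      then show ?thesis using sep[of u v x] uv(3) by blast
    qed
  qed
  ultimately show "RED_LD_set G S" by (simp add: RED_LD_set_def)
qed

end
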